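(* Let $p\in\mathbb{R}[x]$ be a polynomial of degree $d\ge1$ with leading coefficient $c$, and let $\varphi:(\mathbb{N},\cdot)\to(\mathbb{R},+)$ be a semigroup homomorphism such that $c\,\varphi(a)^d\in\mathbb{R}\setminus\mathbb{Q}$ for some $a\in\mathbb{N}$. For every interval $I\subseteq[0,1)$ of positive length, the set $A_I=\{n\in\mathbb{N}:\{p(\varphi(n))\}\in I\}$ is syndetic in $(\mathbb{N},\cdot)$.
   Context: $\{y\}$ is the fractional part of $y$. A set $A\subseteq\mathbb{N}$ is syndetic in $(\mathbb{N},\cdot)$ if there is a finite $F\subseteq\mathbb{N}$ with $\bigcup_{f\in F}\{n\in\mathbb{N}:nf\in A\}=\mathbb{N}$. *)

theory Defs
  imports "HOL-Analysis.Analysis" "HOL-Computational_Algebra.Polynomial"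
begin

text \<open>
  The natural numbers start at 1 here: on a multiplicative semigroup containing 0, every
  homomorphism to the additive reals would be identically 0.
\<close>

abbreviation pos_nats :: "nat set" where
  "pos_nats \<equiv> {0<..}"

definition mult_syndetic :: "nat set \<Rightarrow> bool" where
  "mult_syndetic A \<longleftrightarrow>
     A \<subseteq> pos_nats \<and>
     (\<exists>F. finite F \<and> F \<subseteq> pos_nats \<and> (\<Union>f\<in>F. {n \<in> pos_nats. n * f \<in> A}) = pos_nats)"

text \<open>Values of the function at 0 are irrelevant: only its restriction to the positive integers matters.\<close>

definition mult_add_hom :: "(nat \<Rightarrow> real) \<Rightarrow> bool" where
  "mult_add_hom \<phi> \<longleftrightarrow> (\<forall>m\<in>pos_nats. \<forall>n\<in>pos_nats. \<phi> (m * n) = \<phi> m + \<phi> n)"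

end

theory Submission
  imports Defs
begin

text \<open>
  Along the orbit $n, na, na^2, \ldots$ the values $p(\varphi(n a^k)) = p(\varphi(n) + k\varphi(a))$ are
  those of a polynomial in $k$ of degree $d$ whose leading coefficient $\beta = c\,\varphi(a)^d$ is
  irrational and does not depend on $n$. Weyl's equidistribution theorem holds uniformly over all real
  polynomials of degree $d$ with leading coefficient $\beta$: van der Corput's inequality reduces the
  degree, and the lower coefficients never enter the estimates. Hence there is one $N$ such that for
  every $n$ some $k < N$ satisfies $\{p(\varphi(n a^k))\} \in I$, and $\{a^k : k < N\}$ is
  the finite set required by syndeticity.
\<close>

section \<open>Finite differences of real polynomials\<close>

lemma degree_le_1_eq_pCons:
  "degree p \<le> Suc 0 \<Longrightarrow> p = [:coeff p 0, coeff p (Suc 0):]"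
  by (rule poly_eqI) (auto simp: coeff_pCons coeff_eq_0 split: nat.split)

text \<open>Writing p(x) = a + x r(x) and D(x) = r(x+h) - r(x) gives p(x+h) - p(x) = h (r(x) + D(x))
  + x D(x), which drives an induction. A bound on the degree, instead of its exact value, spares
  case distinctions on h = 0 or a vanishing top coefficient.\<close>

lemma shift_difference_coeff:
  fixes p :: "real poly"
  assumes "degree p \<le> Suc n"
  shows "degree (p \<circ>\<^sub>p [:h, 1:] - p) \<le> n \<and>
         coeff (p \<circ>\<^sub>p [:h, 1:] - p) n = real (Suc n) * h * coeff p (Suc n)"
  using assms
proof (induction n arbitrary: p)
  case 0
  then obtain a b where "p = [:a, b:]"
    using degree_le_1_eq_pCons by blast
  then show ?case by (simp add: pcompose_pCons)
next
  case (Suc n)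
  obtain a r where p: "p = pCons a r" by (cases p)
  have dr: "degree r \<le> Suc n" using Suc.prems p by (auto split: if_splits)
  define D where "D = r \<circ>\<^sub>p [:h, 1:] - r"
  have D: "degree D \<le> n" "coeff D n = real (Suc n) * h * coeff r (Suc n)"
    using Suc.IH[OF dr] by (auto simp: D_def)
  have eq: "p \<circ>\<^sub>p [:h, 1:] - p = smult h (r + D) + pCons 0 D"
    by (simp add: p D_def pcompose_pCons algebra_simps)
  have "degree (smult h (r + D) + pCons 0 D) \<le> Suc n"
    using D(1) dr by (intro degree_add_le order.trans[OF degree_smult_le]) (auto intro: order.trans[OF degree_pCons_le])
  moreover have "coeff D (Suc n) = 0" using D(1) by (simp add: coeff_eq_0)
  ultimately show ?case
    unfolding eq using D(2) by (simp add: p algebra_simps)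
qed

section \<open>Van der Corput's inequality\<close>

text \<open>The sum is compared with its average over \<open>H\<close> shifts, which costs only
  boundary terms. Cauchy-Schwarz in k and expansion of the square then leave correlations of pairs
  of shifts: the \<open>H\<close> diagonal ones produce \<open>1 / H\<close>, the others
  \<delta>.\<close>

lemma van_der_corput:
  fixes u :: "nat \<Rightarrow> complex" and H N :: nat and \<delta> :: real
  assumes u: "\<And>k. norm (u k) \<le> 1" and H: "H > 0" and "\<delta> \<ge> 0"
    and corr: "\<And>h h'. h < H \<Longrightarrow> h' < H \<Longrightarrow> h \<noteq> h' \<Longrightarrow>
      norm (\<Sum>k<N. u (k + h) * cnj (u (k + h'))) \<le> \<delta> * N"
  shows "norm (\<Sum>k<N. u k) \<le> 2 * real H + real N * sqrt (1 / real H + \<delta>)"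
proof -
  define S where "S = (\<Sum>k<N. u k)"
  define v where "v k = (\<Sum>h<H. u (k + h))" for k
  have shift: "norm (S - (\<Sum>k<N. u (k + h))) \<le> 2 * real h" for h
  proof (induction h)
    case 0
    then show ?case by (simp add: S_def)
  next
    case (Suc h)
    \<comment> \<open>One more shift trades a single term at each end of the range, at a cost of at
      most 2.\<close>
    have "(\<Sum>k<N. u (k + h)) - (\<Sum>k<N. u (k + Suc h)) = u h - u (N + h)"
      by (induction N) (auto simp: algebra_simps)
    then have eq: "S - (\<Sum>k<N. u (k + Suc h)) = (S - (\<Sum>k<N. u (k + h))) + (u h - u (N + h))"
      by (simp add: algebra_simps)
    have "norm (u h - u (N + h)) \<le> 2"
      using norm_triangle_ineq4[of "u h" "u (N + h)"] u[of h] u[of "N + h"] by linarith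
    then show ?case
      unfolding eq using Suc.IH norm_triangle_ineq[of "S - (\<Sum>k<N. u (k + h))" "u h - u (N + h)"]
      by simp
  qed
  have "of_nat H * S - (\<Sum>k<N. v k) = (\<Sum>h<H. S - (\<Sum>k<N. u (k + h)))"
    unfolding v_def by (subst sum.swap) (simp add: sum_subtractf)
  also have "norm \<dots> \<le> (\<Sum>h<H. 2 * real H)"
    by (intro sum_norm_le order.trans[OF shift]) auto
  finally have 1: "norm (of_nat H * S - (\<Sum>k<N. v k)) \<le> 2 * H * H" by simp

  have "complex_of_real (\<Sum>k<N. (norm (v k))\<^sup>2) = (\<Sum>k<N. v k * cnj (v k))"
    by (simp only: of_real_sum complex_norm_square)
  also have "\<dots> = (\<Sum>k<N. \<Sum>h<H. \<Sum>h'<H. u (k + h) * cnj (u (k + h')))"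
    by (simp add: v_def sum_product)
  also have "\<dots> = (\<Sum>h<H. \<Sum>h'<H. \<Sum>k<N. u (k + h) * cnj (u (k + h')))"
    by (simp only: sum.swap[where A = "{..<N}"])
  also have "norm \<dots> \<le> (\<Sum>h<H. \<Sum>h'<H. \<delta> * N + (if h = h' then real N else 0))"
  proof (intro sum_norm_le)
    fix h h' assume hh: "h \<in> {..<H}" "h' \<in> {..<H}"
    show "norm (\<Sum>k<N. u (k + h) * cnj (u (k + h'))) \<le> \<delta> * N + (if h = h' then real N else 0)"
    proof (cases "h = h'")
      case True
      have "norm (\<Sum>k<N. u (k + h) * cnj (u (k + h'))) \<le> (\<Sum>k<N. 1)"
        using u by (intro sum_norm_le) (auto simp: norm_mult intro!: mult_le_one)
      then show ?thesis using True \<open>\<delta> \<ge> 0\<close> by (simp add: add_increasing)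
    qed (use corr hh in auto)
  qed
  also have "\<dots> = real H * real N * (1 + H * \<delta>)"
    by (simp add: sum.distrib algebra_simps)
  finally have 2: "(\<Sum>k<N. (norm (v k))\<^sup>2) \<le> real H * real N * (1 + H * \<delta>)"
    unfolding norm_of_real by linarith

  have "(norm (\<Sum>k<N. v k))\<^sup>2 \<le> (\<Sum>k<N. norm (v k))\<^sup>2"
    by (intro power_mono norm_sum) auto
  also have "\<dots> \<le> N * (\<Sum>k<N. (norm (v k))\<^sup>2)"
    using sum_squared_le_sum_of_squares[of "\<lambda>k. norm (v k)" "{..<N}"] by (simp add: mult.commute)
  also have "\<dots> \<le> N * (real H * real N * (1 + H * \<delta>))"
    using 2 by (intro mult_left_mono) auto
  also have "\<dots> = (H * N * sqrt (1 / H + \<delta>))\<^sup>2"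
    using H \<open>\<delta> \<ge> 0\<close> by (simp add: power_mult_distrib power2_eq_square field_simps)
  finally have "norm (\<Sum>k<N. v k) \<le> H * N * sqrt (1 / H + \<delta>)"
    by (rule power2_le_imp_le) (use \<open>\<delta> \<ge> 0\<close> in simp)
  then have "norm (of_nat H * S) \<le> 2 * H * H + H * N * sqrt (1 / H + \<delta>)"
    using 1 norm_triangle_sub[of "of_nat H * S" "\<Sum>k<N. v k"] by linarith
  then have "H * norm S \<le> H * (2 * H + N * sqrt (1 / H + \<delta>))"
    by (simp add: norm_mult algebra_simps)
  then show ?thesis using H by (simp add: S_def)
qed

section \<open>Uniform Weyl estimate for exponential sums\<close>

text \<open>The quantifier over q stands inside the eventuality, so the threshold for N depends only
  on d, \<beta> and \<epsilon>. Induction preserves this: the linear case is a geometric sum bounded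
  in terms of \<beta> alone, and differencing leads to finitely many leading coefficients, all
  determined by \<beta>.\<close>

lemma weyl_sum_uniform:
  fixes \<beta> \<epsilon> :: real
  assumes "\<beta> \<notin> \<rat>" and "\<epsilon> > 0"
  shows "\<forall>\<^sub>F N in sequentially. \<forall>q. degree q \<le> Suc d \<and> coeff q (Suc d) = \<beta> \<longrightarrow>
           norm (\<Sum>k<N. cis (2 * pi * poly q (real k))) \<le> \<epsilon> * N"
  using assms
proof (induction d arbitrary: \<beta> \<epsilon>)
  case 0
  define w where "w = cis (2 * pi * \<beta>)"
  have "w \<noteq> 1"
  proof
    assume "w = 1"
    then have "cos (2 * pi * \<beta>) = 1" by (simp add: w_def complex_eq_iff)
    then obtain i :: int where "2 * pi * \<beta> = i * 2 * pi" by (auto simp: cos_one_2pi_int)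
    then have "\<beta> = of_int i" by simp
    then show False using 0 by simp
  qed
  have bound: "norm (\<Sum>k<N. cis (2 * pi * poly q (real k))) \<le> 2 / norm (w - 1)"
    if q: "degree q \<le> Suc 0" "coeff q (Suc 0) = \<beta>" for N q
  proof -
    obtain b c where "q = [:b, c:]" using degree_le_1_eq_pCons[OF q(1)] by blast
    then have qb: "q = [:b, \<beta>:]" using q(2) by simp
    \<comment> \<open>The constant coefficient contributes only a factor of modulus 1.\<close>
    have "cis (2 * pi * poly q (real k)) = cis (2 * pi * b) * w ^ k" for k
      by (simp add: qb w_def Complex.DeMoivre cis_mult algebra_simps)
    then have "norm (\<Sum>k<N. cis (2 * pi * poly q (real k))) = norm (\<Sum>k<N. w ^ k)"
      by (simp add: sum_distrib_left[symmetric] norm_mult)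
    also have "\<dots> = norm (w ^ N - 1) / norm (w - 1)"
      using \<open>w \<noteq> 1\<close> by (simp add: geometric_sum norm_divide)
    also have "norm (w ^ N - 1) \<le> 2"
      using norm_triangle_ineq4[of "w ^ N" 1] by (simp add: w_def norm_power)
    finally show ?thesis by (simp add: divide_right_mono)
  qed
  have "\<forall>\<^sub>F N in sequentially. 2 / norm (w - 1) / \<epsilon> \<le> real N"
    using filterlim_real_sequentially by (simp add: filterlim_at_top)
  then show ?case
  proof eventually_elim
    case (elim N)
    then have "2 / norm (w - 1) \<le> \<epsilon> * N" using \<open>\<epsilon> > 0\<close> by (simp only: pos_divide_le_eq mult.commute)
    then show ?case by (intro allI impI order.trans[OF bound]) auto
  qed
next
  case (Suc d)
  \<comment> \<open>With both \<open>1 / H\<close> and \<delta> at most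
    \<open>\<epsilon>\<^sup>2 / 8\<close>, the square root in van der Corput's bound is at most
    \<open>\<epsilon> / 2\<close>. The other half of \<epsilon> absorbs the boundary term
    \<open>2 * H\<close> as soon as N is at least \<open>4 * H / \<epsilon>\<close>.\<close>
  define H where "H = nat \<lceil>8 / \<epsilon>\<^sup>2\<rceil>"
  define \<delta> where "\<delta> = \<epsilon>\<^sup>2 / 8"
  have "\<delta> > 0" using Suc.prems by (simp add: \<delta>_def)
  have "8 / \<epsilon>\<^sup>2 > 0" using Suc.prems by simp
  then have H: "H > 0" "8 / \<epsilon>\<^sup>2 \<le> H" by (simp_all only: H_def) (linarith+)
  have "1 / H \<le> \<epsilon>\<^sup>2 / 8" using H Suc.prems by (simp add: field_simps)
  then have "1 / H + \<delta> \<le> (\<epsilon> / 2)\<^sup>2" by (simp add: \<delta>_def power2_eq_square)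
  then have sq: "sqrt (1 / H + \<delta>) \<le> \<epsilon> / 2"
    using Suc.prems by (intro real_le_lsqrt) auto
  \<comment> \<open>This is the coefficient of degree d + 1 in q(x+h) - q(x+h'); for distinct shifts
    it is a nonzero rational multiple of \<beta>.\<close>
  define \<gamma> where "\<gamma> h h' = real (Suc (Suc d)) * (real h - real h') * \<beta>" for h h' :: nat
  have irr: "\<gamma> h h' \<notin> \<rat>" if "h \<noteq> h'" for h h'
  proof
    assume "\<gamma> h h' \<in> \<rat>"
    then have "\<gamma> h h' / (real (Suc (Suc d)) * (real h - real h')) \<in> \<rat>"
      by (intro Rats_divide Rats_mult Rats_diff Rats_of_nat)
    moreover have "\<gamma> h h' / (real (Suc (Suc d)) * (real h - real h')) = \<beta>"
      using that by (simp add: \<gamma>_def del: of_nat_Suc)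
    ultimately show False using Suc.prems by simp
  qed
  have "\<forall>\<^sub>F N in sequentially. \<forall>(h, h') \<in> {(h, h'). h < H \<and> h' < H \<and> h \<noteq> h'}.
      \<forall>q. degree q \<le> Suc d \<and> coeff q (Suc d) = \<gamma> h h' \<longrightarrow>
           norm (\<Sum>k<N. cis (2 * pi * poly q (real k))) \<le> \<delta> * N"
  proof (rule eventually_ball_finite)
    show "finite {(h, h'). h < H \<and> h' < H \<and> h \<noteq> h'}"
      by (rule finite_subset[of _ "{..<H} \<times> {..<H}"]) auto
  qed (use Suc.IH[OF irr \<open>\<delta> > 0\<close>] in auto)
  moreover have "\<forall>\<^sub>F N in sequentially. 4 * H / \<epsilon> \<le> real N"
    using filterlim_real_sequentially by (simp add: filterlim_at_top)
  ultimately show ?case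
  proof eventually_elim
    case (elim N)
    have N: "4 * H \<le> \<epsilon> * N" using elim(2) Suc.prems by (simp add: field_simps)
    show ?case
    proof (intro allI impI)
      fix q :: "real poly" assume q: "degree q \<le> Suc (Suc d) \<and> coeff q (Suc (Suc d)) = \<beta>"
      have "norm (\<Sum>k<N. cis (2 * pi * poly q (real k))) \<le> 2 * real H + real N * sqrt (1 / real H + \<delta>)"
      proof (rule van_der_corput)
        fix h h' assume hh: "h < H" "h' < H" "h \<noteq> h'"
        \<comment> \<open>Subtracting q from both shifts changes nothing, but makes each bracket a
          difference to which \<open>shift_difference_coeff\<close> applies.\<close>
        define r where "r = (q \<circ>\<^sub>p [:real h, 1:] - q) - (q \<circ>\<^sub>p [:real h', 1:] - q)"
        have "degree r \<le> Suc d"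
          unfolding r_def using q
          by (blast intro: degree_diff_le shift_difference_coeff[THEN conjunct1])
        moreover have "coeff r (Suc d) = \<gamma> h h'"
          using shift_difference_coeff[of q "Suc d" "real h"]
            shift_difference_coeff[of q "Suc d" "real h'"] q
          by (auto simp: r_def \<gamma>_def algebra_simps simp del: of_nat_Suc)
        ultimately have "norm (\<Sum>k<N. cis (2 * pi * poly r (real k))) \<le> \<delta> * N"
          using elim(1) hh by blast
        moreover have "cis (2 * pi * poly q (real (k + h))) * cnj (cis (2 * pi * poly q (real (k + h'))))
          = cis (2 * pi * poly r (real k))" for k
          by (simp add: r_def cis_cnj cis_mult poly_pcompose algebra_simps)
        ultimately show "norm (\<Sum>k<N. cis (2 * pi * poly q (real (k + h))) *
          cnj (cis (2 * pi * poly q (real (k + h'))))) \<le> \<delta> * N" by simp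
      qed (use H \<open>\<delta> > 0\<close> in auto)
      also have "\<dots> \<le> 2 * real H + real N * (\<epsilon> / 2)"
        using sq by (intro add_left_mono mult_left_mono) auto
      also have "\<dots> \<le> \<epsilon> * N" using N by (simp add: algebra_simps)
      finally show "norm (\<Sum>k<N. cis (2 * pi * poly q (real k))) \<le> \<epsilon> * N" .
    qed
  qed
qed

section \<open>From exponential sums to visits of arcs and intervals\<close>

text \<open>The square of |1 + e^(ix)| is e^(-ix) (1 + e^(ix))^2, so the binomial theorem yields the
  Fourier expansion of a nonnegative kernel, with frequencies from -M to M and constant term at j =
  M.\<close>

lemma norm_one_plus_cis_power:
  "complex_of_real (norm (1 + cis x) ^ (2 * M)) =
     (\<Sum>j\<le>2 * M. of_nat ((2 * M) choose j) * cis ((real j - real M) * x))"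
proof -
  have "complex_of_real ((norm (1 + cis x))\<^sup>2) = (1 + cis x) * (1 + cis (- x))"
    by (simp add: complex_norm_square cis_cnj del: of_real_power)
  also have "\<dots> = cis (- x) * (cis x + 1)\<^sup>2"
    by (simp add: power2_eq_square algebra_simps cis_mult)
  finally have "complex_of_real (norm (1 + cis x) ^ (2 * M)) = cis (- x) ^ M * (cis x + 1) ^ (2 * M)"
    by (simp add: power_mult power_mult_distrib)
  also have "\<dots> = (\<Sum>j\<le>2 * M. of_nat ((2 * M) choose j) * (cis (- x) ^ M * cis x ^ j))"
    unfolding binomial_ring by (simp add: sum_distrib_left algebra_simps)
  also have "\<dots> = (\<Sum>j\<le>2 * M. of_nat ((2 * M) choose j) * cis ((real j - real M) * x))"
    by (simp add: Complex.DeMoivre cis_mult algebra_simps)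
  finally show ?thesis .
qed

text \<open>As |1 + e^(2 pi i t)| = 2 |cos(pi t)|, the conclusion places a value of q in an arc
  about \<open>x0\<close> modulo 1, in the form that the kernel detects. Were the arc missed for all
  k < N, the average of the kernel would be too small for the Weyl estimate at its nonzero
  frequencies.\<close>

lemma polynomial_hits_arc:
  fixes \<beta> x0 s :: real
  assumes \<beta>: "\<beta> \<notin> \<rat>" and s: "0 \<le> s" "s < 1"
  shows "\<exists>N. \<forall>q. degree q \<le> Suc d \<and> coeff q (Suc d) = \<beta> \<longrightarrow>
           (\<exists>k<N. norm (1 + cis (2 * pi * (poly q (real k) - x0))) > 2 * s)"
proof -
  \<comment> \<open>The kernel \<open>|1 + z| ^ (2 M)\<close> has mean \<open>C = (2 M choose M) \<ge> 4 ^ M / (2 M + 1)\<close> on the circle, which for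
    large \<open>M\<close> exceeds its maximum \<open>(2 s) ^ (2 M)\<close> outside the target arc.\<close>
  have "(\<lambda>M. (2 * real M + 1) * (s\<^sup>2) ^ M) \<longlonglongrightarrow> 0"
  proof -
    have "norm (s\<^sup>2) < 1" using s by (simp add: power_less_one_iff abs_square_less_1)
    from tendsto_add[OF tendsto_mult_left[OF powser_times_n_limit_0[OF this], of 2] LIMSEQ_power_zero[OF this]]
    show ?thesis by (simp add: algebra_simps)
  qed
  then have "\<forall>\<^sub>F M in sequentially. (2 * real M + 1) * (s\<^sup>2) ^ M < 1"
    by (rule order_tendstoD) simp
  then obtain M where M: "(2 * real M + 1) * (s\<^sup>2) ^ M < 1"
    by (auto simp: eventually_sequentially)
  define C where "C = real ((2 * M) choose M)"
  have "(4::real) ^ M \<le> (2 * real M + 1) * C"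
  proof -
    have "(2::nat) ^ (2 * M) = (\<Sum>j\<le>2 * M. (2 * M) choose j)" by (rule choose_row_sum[symmetric])
    also have "\<dots> \<le> (\<Sum>j\<le>2 * M. (2 * M) choose M)"
      by (intro sum_mono binomial_maximum')
    finally have "real (2 ^ (2 * M)) \<le> real ((2 * M + 1) * ((2 * M) choose M))"
      by (simp only: of_nat_le_iff) simp
    moreover have "real (2 ^ (2 * M)) = 4 ^ M" by (simp add: power_mult)
    ultimately show ?thesis by (simp add: C_def algebra_simps)
  qed
  have "(2 * real M + 1) * ((2 * s) ^ (2 * M)) = 4 ^ M * ((2 * real M + 1) * (s\<^sup>2) ^ M)"
    by (simp add: power_mult power_mult_distrib)
  also have "\<dots> < 4 ^ M * 1" using M by (intro mult_strict_left_mono) auto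
  also have "\<dots> \<le> (2 * real M + 1) * C" using \<open>4 ^ M \<le> _\<close> by simp
  finally have sC: "(2 * s) ^ (2 * M) < C" by (simp add: mult_less_cancel_left)
  \<comment> \<open>The binomial weights add up to \<open>4 ^ M\<close>, so the nonconstant
    frequencies together contribute at most half of the gap \<open>C - (2 * s) ^ (2 * M)\<close> per
    term.\<close>
  define \<epsilon> where "\<epsilon> = (C - (2 * s) ^ (2 * M)) / (2 * 4 ^ M)"
  have "\<epsilon> > 0" using sC by (simp add: \<epsilon>_def)
  have "\<forall>\<^sub>F N in sequentially. \<forall>j\<in>{..2 * M} - {M}.
     \<forall>q. degree q \<le> Suc d \<and> coeff q (Suc d) = (real j - real M) * \<beta> \<longrightarrow>
           norm (\<Sum>k<N. cis (2 * pi * poly q (real k))) \<le> \<epsilon> * N"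
  proof (intro eventually_ball_finite ballI weyl_sum_uniform \<open>\<epsilon> > 0\<close>)
    fix j assume j: "j \<in> {..2 * M} - {M}"
    show "(real j - real M) * \<beta> \<notin> \<rat>"
    proof
      assume "(real j - real M) * \<beta> \<in> \<rat>"
      then have "(real j - real M) * \<beta> / (real j - real M) \<in> \<rat>"
        by (intro Rats_divide Rats_diff Rats_of_nat)
      then show False using j \<beta> by simp
    qed
  qed auto
  \<comment> \<open>Positivity of N keeps the final comparison of sums strict.\<close>
  then obtain N where N: "\<And>j q. j \<le> 2 * M \<Longrightarrow> j \<noteq> M \<Longrightarrow> degree q \<le> Suc d \<Longrightarrow>
      coeff q (Suc d) = (real j - real M) * \<beta> \<Longrightarrow>
      norm (\<Sum>k<N. cis (2 * pi * poly q (real k))) \<le> \<epsilon> * N" and "N > 0"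
    unfolding eventually_sequentially by (metis DiffI atMost_iff le_SucI less_Suc_eq_0_disj order_refl singletonD zero_less_Suc)
  show ?thesis
  proof (rule exI[of _ N], intro allI impI)
    fix q :: "real poly" assume q: "degree q \<le> Suc d \<and> coeff q (Suc d) = \<beta>"
    define z where "z k = 2 * pi * (poly q (real k) - x0)" for k :: nat
    define T where "T j = (\<Sum>k<N. cis ((real j - real M) * z k))" for j
    have T: "norm (T j) \<le> \<epsilon> * N" if j: "j \<le> 2 * M" "j \<noteq> M" for j
    proof -
      \<comment> \<open>The frequency j - M multiplies the leading coefficient, while the
        translation by \<open>x0\<close> affects only the constant one.\<close>
      have "degree (smult (real j - real M) (q - [:x0:])) \<le> Suc d"
        using q by (auto intro!: degree_diff_le order.trans[OF degree_smult_le])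
      from N[OF j this] show ?thesis
        using q by (simp add: T_def z_def algebra_simps)
    qed
    have "of_real (\<Sum>k<N. norm (1 + cis (z k)) ^ (2 * M)) =
        (\<Sum>j\<le>2 * M. of_nat ((2 * M) choose j) * T j)"
      unfolding of_real_sum norm_one_plus_cis_power T_def sum_distrib_left by (rule sum.swap)
    also have "\<dots> = of_real (C * N) + (\<Sum>j\<in>{..2 * M} - {M}. of_nat ((2 * M) choose j) * T j)"
      by (subst sum.remove[of _ M]) (auto simp: C_def T_def)
    finally have eq: "complex_of_real ((\<Sum>k<N. norm (1 + cis (z k)) ^ (2 * M)) - C * N) =
        (\<Sum>j\<in>{..2 * M} - {M}. of_nat ((2 * M) choose j) * T j)" by simp
    have "norm (\<Sum>j\<in>{..2 * M} - {M}. of_nat ((2 * M) choose j) * T j)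
        \<le> (\<Sum>j\<in>{..2 * M} - {M}. real ((2 * M) choose j) * (\<epsilon> * N))"
      using T by (intro sum_norm_le) (auto simp: norm_mult intro!: mult_left_mono)
    also have "\<dots> \<le> (\<Sum>j\<le>2 * M. real ((2 * M) choose j) * (\<epsilon> * N))"
      using \<open>\<epsilon> > 0\<close> by (intro sum_mono2) auto
    also have "\<dots> = real (\<Sum>j\<le>2 * M. (2 * M) choose j) * (\<epsilon> * N)"
      by (simp add: sum_distrib_right)
    also have "\<dots> = 4 ^ M * \<epsilon> * N"
      unfolding choose_row_sum by (simp add: power_mult)
    also have "\<dots> < (C - (2 * s) ^ (2 * M)) * N"
      using sC \<open>N > 0\<close> by (simp add: \<epsilon>_def)
    finally have "\<bar>(\<Sum>k<N. norm (1 + cis (z k)) ^ (2 * M)) - C * N\<bar> < (C - (2 * s) ^ (2 * M)) * N"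
      unfolding eq[symmetric] norm_of_real .
    then have less: "(2 * s) ^ (2 * M) * N < (\<Sum>k<N. norm (1 + cis (z k)) ^ (2 * M))"
      by (simp add: algebra_simps abs_if split: if_splits)
    have "\<exists>k<N. norm (1 + cis (z k)) ^ (2 * M) > (2 * s) ^ (2 * M)"
    proof (rule ccontr)
      assume "\<not> ?thesis"
      then have "(\<Sum>k<N. norm (1 + cis (z k)) ^ (2 * M)) \<le> (\<Sum>k<N. (2 * s) ^ (2 * M))"
        by (intro sum_mono) (meson lessThan_iff not_less)
      then show False using less by (simp add: mult.commute)
    qed
    then show "\<exists>k<N. norm (1 + cis (2 * pi * (poly q (real k) - x0))) > 2 * s"
      unfolding z_def by (meson power_less_imp_less_base norm_ge_zero)
  qed
qed

text \<open>The open interval is the arc of half-length \<delta> about its midpoint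
  \<open>x0\<close>, and \<open>2 * cos (pi * \<delta>)\<close> is the value of |1 + e^(2 pi i (y -
  x0))| at its endpoints.\<close>

lemma polynomial_hits_interval:
  fixes \<beta> a b :: real
  assumes \<beta>: "\<beta> \<notin> \<rat>" and ab: "0 \<le> a" "a < b" "b \<le> 1"
  shows "\<exists>N. \<forall>q. degree q \<le> Suc d \<and> coeff q (Suc d) = \<beta> \<longrightarrow>
           (\<exists>k<N. frac (poly q (real k)) \<in> {a<..<b})"
proof -
  define x0 where "x0 = (a + b) / 2"
  define \<delta> where "\<delta> = (b - a) / 2"
  have \<delta>: "0 < \<delta>" "\<delta> \<le> 1 / 2" "\<delta> \<le> x0" "x0 \<le> 1 - \<delta>" using ab by (auto simp: x0_def \<delta>_def field_simps)
  define s where "s = cos (pi * \<delta>)"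
  have pd: "0 < pi * \<delta>" "pi * \<delta> \<le> pi / 2" using \<delta> by auto
  have s: "0 \<le> s" unfolding s_def by (rule cos_ge_zero) (use pd pi_gt_zero in linarith)+
  have "cos (pi * \<delta>) < cos 0" by (rule cos_monotone_0_pi) (use pd pi_gt_zero in linarith)+
  then have s1: "s < 1" by (simp add: s_def)
  have key: "y \<in> {a<..<b}" if y: "0 \<le> y" "y < 1" and n: "norm (1 + cis (2 * pi * (y - x0))) > 2 * s" for y
  proof (rule ccontr)
    assume "y \<notin> {a<..<b}"
    \<comment> \<open>The upper bound holds since \<open>x0\<close> lies between \<delta> and 1 -
      \<delta>. It excludes distances near 1, where |cos| is large again.\<close>
    then have t: "\<delta> \<le> \<bar>y - x0\<bar>" "\<bar>y - x0\<bar> \<le> 1 - \<delta>"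
      using y \<delta> by (auto simp: x0_def \<delta>_def field_simps abs_if)
    have "(norm (1 + cis (2 * pi * (y - x0))))\<^sup>2 = (2 * cos (pi * (y - x0)))\<^sup>2"
    proof -
      have "(norm (1 + cis (2 * x)))\<^sup>2 = (2 * cos x)\<^sup>2" for x
      proof -
        have "(norm (1 + cis (2 * x)))\<^sup>2 = (1 + cos (2 * x))\<^sup>2 + (sin (2 * x))\<^sup>2"
          by (simp add: cmod_power2)
        also have "\<dots> = 2 + 2 * cos (2 * x)"
          using sin_cos_squared_add[of "2 * x"] by (simp add: power2_eq_square algebra_simps)
        also have "\<dots> = (2 * cos x)\<^sup>2" by (simp add: cos_double_cos power2_eq_square)
        finally show ?thesis .
      qed
      from this[of "pi * (y - x0)"] show ?thesis by (simp only: mult.assoc)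
    qed
    then have "norm (1 + cis (2 * pi * (y - x0))) = \<bar>2 * cos (pi * (y - x0))\<bar>"
      by (rule power2_eq_imp_eq[OF _ norm_ge_zero abs_ge_zero, unfolded power2_abs])
    moreover have "\<bar>cos (pi * (y - x0))\<bar> \<le> s"
    proof -
      have c: "cos (pi * (y - x0)) = cos (pi * \<bar>y - x0\<bar>)"
        by (metis abs_mult abs_of_nonneg cos_abs_real pi_ge_zero)
      have "cos (pi * \<bar>y - x0\<bar>) \<le> cos (pi * \<delta>)"
        using t \<delta> by (intro cos_monotone_0_pi_le) auto
      moreover have "cos (pi * (1 - \<delta>)) \<le> cos (pi * \<bar>y - x0\<bar>)"
        using t \<delta> by (intro cos_monotone_0_pi_le mult_left_mono) auto
      moreover have "cos (pi * (1 - \<delta>)) = - cos (pi * \<delta>)"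
        by (simp add: algebra_simps)
      ultimately show ?thesis by (simp add: c s_def abs_le_iff)
    qed
    ultimately show False using n by (simp add: abs_mult)
  qed
  obtain N where N: "\<forall>q. degree q \<le> Suc d \<and> coeff q (Suc d) = \<beta> \<longrightarrow>
           (\<exists>k<N. norm (1 + cis (2 * pi * (poly q (real k) - x0))) > 2 * s)"
    using polynomial_hits_arc[OF \<beta> s s1] by blast
  \<comment> \<open>The arc condition has period 1, so q(k) may replace its fractional part.\<close>
  have per: "cis (2 * pi * (frac x - x0)) = cis (2 * pi * (x - x0))" for x
  proof -
    have "cis (2 * pi * (x - x0)) = cis (2 * pi * (frac x - x0)) * cis (2 * pi * of_int \<lfloor>x\<rfloor>)"
      by (simp add: cis_mult frac_def algebra_simps)
    also have "cis (2 * pi * of_int \<lfloor>x\<rfloor>) = 1" by (rule cis_multiple_2pi) simp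
    finally show ?thesis by simp
  qed
  show ?thesis
    using N key[OF frac_ge_0 frac_lt_1] unfolding per by meson
qed

section \<open>Syndeticity from uniform hitting times\<close>

theorem theorem6p11:
  fixes p :: "real poly" and d :: nat and c :: real
    and \<phi> :: "nat \<Rightarrow> real" and I :: "real set"
  assumes "degree p = d" and "d \<ge> 1" and "lead_coeff p = c"
    and "mult_add_hom \<phi>"
    and "\<exists>a\<in>pos_nats. c * \<phi> a ^ d \<notin> \<rat>"
    and "is_interval I" and "I \<subseteq> {0..<1}" and "measure lborel I > 0"
  shows "mult_syndetic {n \<in> pos_nats. frac (poly p (\<phi> n)) \<in> I}"
proof -
  obtain a where a: "a > 0" "c * \<phi> a ^ d \<notin> \<rat>" using assms(5) by auto
  \<comment> \<open>Otherwise the product would be 0, which is rational, because d is at least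
    1.\<close>
  then have "\<phi> a \<noteq> 0" using assms(2) by (auto simp: power_0_left)
  obtain m where m: "d = Suc m" using assms(2) by (cases d) auto
  \<comment> \<open>Positive measure serves to provide two distinct points; the open interval
    between them is the target.\<close>
  obtain x y where xy: "x \<in> I" "y \<in> I" "x < y"
  proof -
    have "\<not> (\<exists>x. I \<subseteq> {x})"
    proof
      assume "\<exists>x. I \<subseteq> {x}"
      then have "measure lborel I = 0" by (auto simp: subset_singleton_iff)
      then show False using assms(8) by simp
    qed
    then obtain x y where "x \<in> I" "y \<in> I" "x \<noteq> y" by blast
    then show thesis using that by (cases "x < y") auto
  qed
  have sub: "{x<..<y} \<subseteq> I"
  proof
    fix t assume "t \<in> {x<..<y}"
    then have "x \<le> t" "t \<le> y" by auto
    then show "t \<in> I" using assms(6) xy(1,2) unfolding is_interval_1 by blast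
  qed
  \<comment> \<open>This N is fixed before any n is chosen, which makes the set of multipliers
    finite.\<close>
  obtain N where N: "\<And>q. degree q \<le> d \<Longrightarrow> coeff q d = c * \<phi> a ^ d \<Longrightarrow>
      \<exists>k<N. frac (poly q (real k)) \<in> {x<..<y}"
  proof -
    have "0 \<le> x" "y \<le> 1" using xy assms(7) by (auto simp: subset_eq less_imp_le)
    from polynomial_hits_interval[OF a(2) this(1) xy(3) this(2), of m]
    show thesis using that unfolding m by blast
  qed
  have hom: "\<phi> (n * a ^ k) = \<phi> n + real k * \<phi> a" if "n > 0" for n k
  proof (induction k)
    case (Suc k)
    have "\<phi> ((n * a ^ k) * a) = \<phi> (n * a ^ k) + \<phi> a"
      using assms(4) that a(1) unfolding mult_add_hom_def by auto
    then show ?case using Suc by (simp add: algebra_simps)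
  qed simp
  have hit: "\<exists>k<N. frac (poly p (\<phi> (n * a ^ k))) \<in> I" if n: "n > 0" for n
  proof -
    \<comment> \<open>Only the lower coefficients of q involve \<open>\<phi> n\<close>; the leading
      one is the same for every n.\<close>
    define q where "q = p \<circ>\<^sub>p [:\<phi> n, \<phi> a:]"
    have deg: "degree q = d" using assms(1) \<open>\<phi> a \<noteq> 0\<close> by (simp add: q_def degree_pcompose)
    have "lead_coeff q = c * \<phi> a ^ d"
      unfolding q_def using assms(1,3) \<open>\<phi> a \<noteq> 0\<close> by (subst lead_coeff_comp) auto
    then obtain k where "k < N" "frac (poly q (real k)) \<in> {x<..<y}"
      using N[of q] deg by auto
    moreover have "poly q (real k) = poly p (\<phi> (n * a ^ k))"
      by (simp add: q_def poly_pcompose hom[OF n])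
    ultimately show ?thesis using sub by auto
  qed
  show ?thesis
    unfolding mult_syndetic_def
  proof (intro conjI exI[of _ "(\<lambda>k. a ^ k) ` {..<N}"] subset_antisym)
    show "pos_nats \<subseteq> (\<Union>f\<in>(\<lambda>k. a ^ k) ` {..<N}.
      {n \<in> pos_nats. n * f \<in> {n \<in> pos_nats. frac (poly p (\<phi> n)) \<in> I}})"
    proof
      fix n :: nat assume "n \<in> pos_nats"
      moreover from this obtain k where "k < N" "frac (poly p (\<phi> (n * a ^ k))) \<in> I"
        using hit by auto
      ultimately show "n \<in> (\<Union>f\<in>(\<lambda>k. a ^ k) ` {..<N}.
        {n \<in> pos_nats. n * f \<in> {n \<in> pos_nats. frac (poly p (\<phi> n)) \<in> I}})"
        using a(1) by (intro UN_I[of "a ^ k"]) auto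
    qed
  qed (use a(1) in auto)
qed

end
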